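(* Let $\mathcal{I}$ be a unit-budget weighted Firefighter instance with depth $L$, and let $\delta\in(0,1)$. Then one can efficiently construct a push-down $\overline{\mathcal{I}}$ of $\mathcal{I}$ such that (i) $\mathrm{val}(\mathsf{OPT}(\overline{\mathcal{I}}))\ge(1-\delta)\mathrm{val}(\mathsf{OPT}(\mathcal{I}))$, and (ii) $\overline{\mathcal{I}}$ has nonzero budget on only $O(\frac{\log L}{\delta})$ levels.
   Context: Weighted Firefighter problem with general budgets: tree $G=(V,E)$ rooted at $r$, depth $L$, weights $w(u)\in\mathbb{Z}_{\ge0}$ for $u\ne r$, budgets $B_\ell\in\mathbb{Z}_{\ge0}$ for $\ell\in[L]$ (unit-budget: all $B_\ell=1$). A feasible solution is $S\subseteq V\setminus\{r\}$ with $|S\cap V_{\le\ell}|\le\sum_{i=1}^\ell B_i$ for all $\ell$ ($V_{\le\ell}$ = vertices at distance $1,\dots,\ell$ from $r$); its value is $w(\bigcup_{u\in S}T_u)$, $T_u$ the subtree vertex set at $u$; $\mathrm{val}(\mathsf{OPT}(\cdot))$ is the optimal value. A down-push on levels $\ell_1<\ell_2$ moves the budget of level $\ell_1$ to level $\ell_2$: the new budget of $\ell_2$ is $B_{\ell_1}+B_{\ell_2}$ and that of $\ell_1$ is $0$. A push-down of $\mathcal{I}$ is an instance obtained from $\mathcal{I}$ by a sequence of down-pushes (same tree and weights). *)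

theory Defs
  imports
    Complex_Main
    "HOL-Library.Log_Nat"
    "HOL-Computational_Algebra.Polynomial"
    "Graph_Theory.Digraph_Component"
begin

section \<open>Weighted Firefighter instances on rooted trees\<close>

text \<open>
  Undirected simple graphs are the symmetric digraphs of the locale \<^locale>\<open>pair_graph\<close>. The
  predicate \<^const>\<open>forest\<close> (hence \<^const>\<open>tree\<close>) is unsuitable for them, because a directed cycle
  may traverse an edge back and forth; the cycles of the undirected graph are exactly the
  directed cycles with at least three arcs.
\<close>

definition undirected_tree :: "'a pair_pre_digraph \<Rightarrow> bool" where
  "undirected_tree G \<longleftrightarrow>
     pair_graph G \<and> connected (with_proj G) \<and>
     \<not> (\<exists>p. pre_digraph.cycle (with_proj G) p \<and> 3 \<le> length p)"

text \<open>
  Vertices are natural numbers, so that instances can be given to an algorithm. Only the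
  values of \<open>weight\<close> on non-root vertices and of \<open>budget\<close> on the levels
  \<open>1, \<dots>, L\<close> are meaningful, where \<open>L\<close> is the depth of the tree.
\<close>

record instnc =
  graph_of :: "nat pair_pre_digraph"
  root :: nat
  weight :: "nat \<Rightarrow> nat"
  budget :: "nat \<Rightarrow> nat"

abbreviation vertices :: "instnc \<Rightarrow> nat set" where
  "vertices I \<equiv> pverts (graph_of I)"

definition firefighter :: "instnc \<Rightarrow> bool" where
  "firefighter I \<longleftrightarrow> undirected_tree (graph_of I) \<and> root I \<in> vertices I"

text \<open>Distance from the root, as the number of edges of a shortest walk.\<close>

definition level :: "instnc \<Rightarrow> nat \<Rightarrow> nat" where
  "level I v = (LEAST n. \<exists>p. pre_digraph.awalk (with_proj (graph_of I)) (root I) p v \<and> length p = n)"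

definition depth :: "instnc \<Rightarrow> nat" where
  "depth I = Max (level I ` vertices I)"

definition up_to_level :: "instnc \<Rightarrow> nat \<Rightarrow> nat set" where
  "up_to_level I l = {v \<in> vertices I. 1 \<le> level I v \<and> level I v \<le> l}"

definition subtree :: "instnc \<Rightarrow> nat \<Rightarrow> nat set" where
  "subtree I u = {v \<in> vertices I. \<exists>p. pre_digraph.apath (with_proj (graph_of I)) (root I) p v \<and>
     u \<in> set (pre_digraph.awalk_verts (with_proj (graph_of I)) (root I) p)}"

definition feasible :: "instnc \<Rightarrow> nat set \<Rightarrow> bool" where
  "feasible I S \<longleftrightarrow> S \<subseteq> vertices I - {root I} \<and>
     (\<forall>l\<in>{1..depth I}. card (S \<inter> up_to_level I l) \<le> (\<Sum>i=1..l. budget I i))"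

definition solution_value :: "instnc \<Rightarrow> nat set \<Rightarrow> nat" where
  "solution_value I S = sum (weight I) (\<Union>u\<in>S. subtree I u)"

definition val_opt :: "instnc \<Rightarrow> nat" where
  "val_opt I = Max {solution_value I S | S. feasible I S}"

definition unit_budget :: "instnc \<Rightarrow> bool" where
  "unit_budget I \<longleftrightarrow> (\<forall>l\<in>{1..depth I}. budget I l = 1)"

definition active_levels :: "instnc \<Rightarrow> nat set" where
  "active_levels I = {l \<in> {1..depth I}. budget I l \<noteq> 0}"

inductive down_push :: "instnc \<Rightarrow> instnc \<Rightarrow> bool" where
  "1 \<le> l1 \<Longrightarrow> l1 < l2 \<Longrightarrow> l2 \<le> depth I \<Longrightarrow>
     down_push I (I\<lparr>budget := (budget I)(l2 := budget I l1 + budget I l2, l1 := 0)\<rparr>)"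

text \<open>\<open>push_down I J\<close>: the instance \<open>J\<close> is a push-down of \<open>I\<close>.\<close>

definition push_down :: "instnc \<Rightarrow> instnc \<Rightarrow> bool" where
  "push_down = down_push\<^sup>*\<^sup>*"


section \<open>Polynomial-time computation\<close>

text \<open>
  The machine model is a random access machine over the natural numbers, given as structured
  programs over finitely many directly addressed registers and an indirectly addressed memory.
  Every operation and every test takes one time unit. Addition and truncated subtraction are the
  only arithmetic operations: under this uniform cost measure each step lengthens the largest
  number by at most one bit, so that polynomial time coincides with polynomial time on Turing
  machines. This would fail with multiplication.
\<close>

datatype instr =
    Const nat nat      \<comment> \<open>\<open>r x := n\<close>\<close>
  | Add nat nat nat    \<comment> \<open>\<open>r x := r y + r z\<close>\<close>
  | Sub nat nat nat    \<comment> \<open>\<open>r x := r y - r z\<close>, truncated at \<open>0\<close>\<close>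
  | Load nat nat       \<comment> \<open>\<open>r x := m (r y)\<close>\<close>
  | Store nat nat      \<comment> \<open>\<open>m (r x) := r y\<close>\<close>

datatype program =
    Skip
  | Op instr
  | Seq program program
  | IfNZ nat program program
  | WhileNZ nat program

type_synonym state = "(nat \<Rightarrow> nat) \<times> (nat \<Rightarrow> nat)"  \<comment> \<open>registers and memory\<close>

fun step :: "instr \<Rightarrow> state \<Rightarrow> state" where
  "step (Const x n) (r, m) = (r(x := n), m)"
| "step (Add x y z) (r, m) = (r(x := r y + r z), m)"
| "step (Sub x y z) (r, m) = (r(x := r y - r z), m)"
| "step (Load x y) (r, m) = (r(x := m (r y)), m)"
| "step (Store x y) (r, m) = (r, m(r x := r y))"

text \<open>\<open>exec P s t s'\<close>: started in \<open>s\<close>, the program \<open>P\<close> halts in \<open>s'\<close> after exactly \<open>t\<close> time units.\<close>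

inductive exec :: "program \<Rightarrow> state \<Rightarrow> nat \<Rightarrow> state \<Rightarrow> bool" where
  exec_Skip: "exec Skip s 1 s"
| exec_Op: "exec (Op i) s 1 (step i s)"
| exec_Seq: "exec P s t s' \<Longrightarrow> exec Q s' t' s'' \<Longrightarrow> exec (Seq P Q) s (t + t') s''"
| exec_IfTrue: "fst s x \<noteq> 0 \<Longrightarrow> exec P s t s' \<Longrightarrow> exec (IfNZ x P Q) s (t + 1) s'"
| exec_IfFalse: "fst s x = 0 \<Longrightarrow> exec Q s t s' \<Longrightarrow> exec (IfNZ x P Q) s (t + 1) s'"
| exec_WhileTrue: "fst s x \<noteq> 0 \<Longrightarrow> exec P s t s' \<Longrightarrow> exec (WhileNZ x P) s' t' s'' \<Longrightarrow>
    exec (WhileNZ x P) s (t + t' + 1) s''"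
| exec_WhileFalse: "fst s x = 0 \<Longrightarrow> exec (WhileNZ x P) s 1 s"

text \<open>
  Scalar arguments are passed in the first registers and the input word in the first memory cells;
  everything else is initially zero. The output word is left in the first memory cells.
\<close>

definition zero_padded :: "nat list \<Rightarrow> nat \<Rightarrow> nat" where
  "zero_padded xs i = (if i < length xs then xs ! i else 0)"

definition computes_within :: "program \<Rightarrow> nat list \<Rightarrow> nat list \<Rightarrow> nat list \<Rightarrow> nat \<Rightarrow> bool" where
  "computes_within P args xs ys T \<longleftrightarrow>
     (\<exists>t r m. exec P (zero_padded args, zero_padded xs) t (r, m) \<and> t \<le> T \<and>
        (\<forall>i<length ys. m i = ys ! i))"

text \<open>Bit length of a list of numbers in binary, with one separator per entry.\<close>

definition bit_size :: "nat list \<Rightarrow> nat" where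
  "bit_size xs = (\<Sum>x\<leftarrow>xs. floorlog 2 x + 1)"

text \<open>
  Self-delimiting encoding: depth, budgets, root, vertices, weights of the non-root vertices, and
  both orientations of each edge.
\<close>

definition vertex_list :: "instnc \<Rightarrow> nat list" where
  "vertex_list I = sorted_list_of_set (vertices I)"

definition arc_list :: "instnc \<Rightarrow> (nat \<times> nat) list" where
  "arc_list I = filter (\<lambda>e. e \<in> parcs (graph_of I)) (List.product (vertex_list I) (vertex_list I))"

definition encode :: "instnc \<Rightarrow> nat list" where
  "encode I =
     depth I # map (budget I) [1..<Suc (depth I)] @
     root I # length (vertex_list I) # vertex_list I @
     map (weight I) (filter (\<lambda>v. v \<noteq> root I) (vertex_list I)) @
     length (arc_list I) # concat (map (\<lambda>(u, v). [u, v]) (arc_list I))"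

end

theory Submission
  imports Defs
begin

text \<open>
  Let \<open>q = \<lceil>1 / \<delta>\<rceil>\<close>. Order an optimal solution by level and discard one residue class modulo
  \<open>q\<close> of positions; the lightest class costs at most a \<open>1 / q\<close> fraction of the value, and at most
  \<open>l - l div q\<close> vertices remain up to level \<open>l\<close>. It therefore suffices to push budgets down
  greedily as long as every prefix \<open>{1..l}\<close> keeps a total of at least \<open>l - l div q\<close>. Consecutive
  levels that keep budget then grow by a factor \<open>q / (q - 1)\<close>, so there are about \<open>q * ln L\<close> of
  them, and a single linear sweep over the levels computes the new budgets.
\<close>

section \<open>Discarding every \<open>q\<close>-th element\<close>

text \<open>Each of the \<open>n div q\<close> full blocks of \<open>q\<close> consecutive indices
  below \<open>n\<close> contains one index of residue \<open>t\<close>, namely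
  \<open>j * q + t\<close>.\<close>

lemma card_residue_class_ge:
  fixes q t n :: nat
  assumes "t < q"
  shows "n div q \<le> card {i. i < n \<and> i mod q = t}"
proof -
  have "inj_on (\<lambda>j. j * q + t) {..<n div q}"
    using assms by (auto simp: inj_on_def)
  then have "card ((\<lambda>j. j * q + t) ` {..<n div q}) = n div q"
    by (simp add: card_image)
  moreover have "(\<lambda>j. j * q + t) ` {..<n div q} \<subseteq> {i. i < n \<and> i mod q = t}"
  proof (intro subsetI, elim imageE)
    fix i j assume i: "i = j * q + t" and j: "j \<in> {..<n div q}"
    have "Suc j * q \<le> n div q * q"
      using j by (intro mult_le_mono1) simp
    also have "\<dots> \<le> n" by simp
    finally show "i \<in> {i. i < n \<and> i mod q = t}"
      using assms unfolding i mult_Suc by (simp add: add.commute)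
  qed
  moreover have "finite {i. i < n \<and> i mod q = t}" by simp
  ultimately show ?thesis using card_mono by metis
qed

lemma down_closed_eq_lessThan:
  fixes A :: "nat set"
  assumes "finite A" and "\<And>i j. i \<in> A \<Longrightarrow> j \<le> i \<Longrightarrow> j \<in> A"
  shows "A = {..<card A}"
proof -
  have "A \<subseteq> {..<card A}"
  proof
    fix i assume "i \<in> A"
    then have "{..i} \<subseteq> A" using assms(2) by auto
    then have "card {..i} \<le> card A" using assms(1) by (intro card_mono)
    then show "i \<in> {..<card A}" by simp
  qed
  then show ?thesis
    by (intro card_subset_eq) simp_all
qed

text \<open>Raising the argument by one raises the quotient by at most one. This carries the
  sparsified count over to levels where a solution spends less than its full budget.\<close>

lemma sub_div_mono:
  fixes m n q :: nat
  assumes "m \<le> n" "0 < q"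
  shows "m - m div q \<le> n - n div q"
  using assms(1)
proof (induction rule: dec_induct)
  case (step k)
  have "k - k div q \<le> Suc k - Suc k div q"
    using assms(2) by (simp add: div_Suc diff_le_mono)
  with step.IH show ?case by simp
qed simp

text \<open>Averaging over the \<open>q\<close> residue classes of positions in the order sorted by
  \<open>h\<close> yields one class \<open>R\<close> that is light. Every class meets each initial
  segment often enough, so this single \<open>R\<close> serves all thresholds \<open>l\<close> at
  once.\<close>

lemma exists_light_sparsification:
  fixes h c :: "'a \<Rightarrow> nat"
  assumes fin: "finite S" and q: "0 < q"
  obtains R where "R \<subseteq> S" "q * sum c R \<le> sum c S"
    "\<And>l. card {s \<in> S - R. h s \<le> l} \<le>
         card {s \<in> S. h s \<le> l} - card {s \<in> S. h s \<le> l} div q"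
proof -
  obtain ys where ys: "set ys = S" "distinct ys"
    using fin finite_distinct_list by blast
  define xs where "xs = sort_key h ys"
  have xs: "set xs = S" "distinct xs" "sorted (map h xs)"
    using ys by (auto simp: xs_def)
  define n where "n = length xs"
  have inj: "inj_on ((!) xs) {..<n}"
    using xs(2) by (auto simp: inj_on_def n_def nth_eq_iff_index_eq)
  have S: "S = (!) xs ` {..<n}"
    using xs(1) by (auto simp: n_def in_set_conv_nth)
  define R where "R t = (!) xs ` {i. i < n \<and> i mod q = t}" for t
  have "sum c S = (\<Sum>i<n. c (xs ! i))"
    unfolding S using inj by (simp add: sum.reindex)
  also have "\<dots> = (\<Sum>t<q. \<Sum>i\<in>{i \<in> {..<n}. i mod q = t}. c (xs ! i))"
    using q by (intro sum.group[symmetric]) auto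
  also have "\<dots> = (\<Sum>t<q. sum c (R t))"
  proof (intro sum.cong refl)
    fix t
    have "inj_on ((!) xs) {i. i < n \<and> i mod q = t}"
      using inj by (rule inj_on_subset) auto
    then show "(\<Sum>i\<in>{i \<in> {..<n}. i mod q = t}. c (xs ! i)) = sum c (R t)"
      by (simp add: R_def sum.reindex)
  qed
  finally have total: "sum c S = (\<Sum>t<q. sum c (R t))" .
  \<comment> \<open>Pigeonhole: if every class weighed more than the average, the \<open>q\<close>
    classes together would exceed the total.\<close>
  have "\<exists>t<q. q * sum c (R t) \<le> sum c S"
  proof (rule ccontr)
    assume "\<not> (\<exists>t<q. q * sum c (R t) \<le> sum c S)"
    then have "(\<Sum>t<q. sum c S) < (\<Sum>t<q. q * sum c (R t))"
      using q by (intro sum_strict_mono) auto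
    then show False
      using total by (simp flip: sum_distrib_left)
  qed
  then obtain t where t: "t < q" "q * sum c (R t) \<le> sum c S" by blast
  show thesis
  proof
    show "R t \<subseteq> S" by (auto simp: R_def S)
    show "q * sum c (R t) \<le> sum c S" by fact
    fix l
    define A where "A = {i. i < n \<and> h (xs ! i) \<le> l}"
    \<comment> \<open>By sortedness the positions with key at most \<open>l\<close> form an initial
      segment, where the residue count applies.\<close>
    have A: "A = {..<card A}"
    proof (rule down_closed_eq_lessThan)
      show "finite A" by (simp add: A_def)
      fix i j assume "i \<in> A" "j \<le> i"
      moreover have "h (xs ! j) \<le> h (xs ! i)"
        using xs(3) \<open>i \<in> A\<close> \<open>j \<le> i\<close>
        by (auto simp: sorted_iff_nth_mono A_def n_def)
      ultimately show "j \<in> A" by (auto simp: A_def)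
    qed
    have An: "A \<subseteq> {..<n}" by (auto simp: A_def)
    have "{s \<in> S. h s \<le> l} = (!) xs ` A"
      by (auto simp: S A_def)
    then have N: "card {s \<in> S. h s \<le> l} = card A"
      using inj An by (metis card_image inj_on_subset)
    define B where "B = {i. i < card A \<and> i mod q = t}"
    have mem_A: "i \<in> A \<longleftrightarrow> i < card A" for i by (subst A) simp
    have BA: "B \<subseteq> A" by (auto simp: B_def mem_A)
    have finA: "finite A" using An finite_subset by blast
    \<comment> \<open>Positions in \<open>A\<close> of residue \<open>t\<close> belong to
      \<open>R t\<close>, so the surviving elements come from \<open>A - B\<close>.\<close>
    have "{s \<in> S - R t. h s \<le> l} \<subseteq> (!) xs ` (A - B)"
    proof
      fix s assume s: "s \<in> {s \<in> S - R t. h s \<le> l}"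
      then obtain i where i: "i < n" "s = xs ! i" using S by auto
      then have "i \<in> A" "i mod q \<noteq> t" using s by (auto simp: A_def R_def)
      then have "i \<in> A - B" by (simp add: B_def)
      then show "s \<in> (!) xs ` (A - B)" using i(2) by blast
    qed
    then have "card {s \<in> S - R t. h s \<le> l} \<le> card ((!) xs ` (A - B))"
      using finA by (intro card_mono) auto
    also have "\<dots> \<le> card (A - B)"
      using finA by (intro card_image_le) auto
    also have "\<dots> = card A - card B"
      using BA finA by (intro card_Diff_subset) (auto intro: finite_subset)
    also have "\<dots> \<le> card A - card A div q"
      using card_residue_class_ge[OF t(1), of "card A"] by (simp add: B_def diff_le_mono2)
    finally show "card {s \<in> S - R t. h s \<le> l} \<le>
        card {s \<in> S. h s \<le> l} - card {s \<in> S. h s \<le> l} div q"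
      by (simp add: N)
  qed
qed


section \<open>The compressed budgets\<close>

text \<open>
  \<open>pushed_total q L l\<close> is both the last level up to \<open>l\<close> that keeps budget and the total
  budget of the levels up to \<open>l\<close>.
\<close>

fun pushed_total :: "nat \<Rightarrow> nat \<Rightarrow> nat \<Rightarrow> nat" where
  "pushed_total q L 0 = 0"
| "pushed_total q L (Suc l) =
    (if pushed_total q L l < Suc l - Suc l div q \<or> Suc l = L then Suc l else pushed_total q L l)"

definition pushed_budget :: "nat \<Rightarrow> nat \<Rightarrow> nat \<Rightarrow> nat" where
  "pushed_budget q L l = pushed_total q L l - pushed_total q L (l - 1)"

lemma pushed_total_le: "pushed_total q L l \<le> l"
  by (induction l) auto

text \<open>Where a level does not keep budget, the failed test of \<open>pushed_total\<close> is
  precisely this bound.\<close>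

lemma pushed_total_ge: "l - l div q \<le> pushed_total q L l"
  by (induction l) auto

text \<open>The clause \<open>Suc l = L\<close> makes the last level keep whatever is left, since
  nothing can be pushed further.\<close>

lemma pushed_total_final: "pushed_total q L L = L"
  by (cases L) auto

lemma pushed_total_mono_Suc: "pushed_total q L l \<le> pushed_total q L (Suc l)"
  using pushed_total_le[of q L l] by simp

text \<open>The sum telescopes; monotonicity of \<open>pushed_total\<close> keeps the truncated
  differences exact.\<close>

lemma sum_pushed_budget: "(\<Sum>i=1..l. pushed_budget q L i) = pushed_total q L l"
proof (induction l)
  case (Suc l)
  then show ?case
    using pushed_total_mono_Suc[of q L l] by (simp add: pushed_budget_def del: pushed_total.simps)
qed simp

text \<open>
  A new active level \<open>l\<close> following the active level \<open>a\<close> satisfies \<open>l - l div q \<ge> a + 1\<close>,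
  hence \<open>l + 1 \<ge> (a + 1) q / (q - 1)\<close>: active levels grow geometrically.
\<close>

lemma active_growth:
  assumes "0 < q" "l < L"
  shows "q ^ card {i \<in> {1..l}. pushed_budget q L i \<noteq> 0} \<le>
    (q - 1) ^ card {i \<in> {1..l}. pushed_budget q L i \<noteq> 0} * Suc (pushed_total q L l)"
  using assms(2)
proof (induction l)
  case (Suc l)
  let ?A = "\<lambda>l. {i \<in> {1..l}. pushed_budget q L i \<noteq> 0}"
  define a where "a = pushed_total q L l"
  have al: "a \<le> l" by (simp add: a_def pushed_total_le)
  have IH: "q ^ card (?A l) \<le> (q - 1) ^ card (?A l) * Suc a"
    using Suc by (simp add: a_def)
  show ?case
  proof (cases "a < Suc l - Suc l div q")
    case True
    then have total: "pushed_total q L (Suc l) = Suc l" by (simp add: a_def)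
    then have "pushed_budget q L (Suc l) \<noteq> 0"
      using al by (simp add: pushed_budget_def a_def)
    then have "?A (Suc l) = insert (Suc l) (?A l)"
      by (auto simp: le_Suc_eq)
    then have card: "card (?A (Suc l)) = Suc (card (?A l))" by simp
    obtain p where p: "q = Suc p" using assms(1) by (cases q) auto
    then have q1: "q - 1 = p" by simp
    \<comment> \<open>A remainder of at most \<open>p = q - 1\<close> gives
      \<open>q * (Suc l div q) \<ge> Suc l - p\<close>, hence
      \<open>q * Suc a \<le> q * Suc l - Suc l + p = p * Suc (Suc l)\<close>.\<close>
    have "Suc l = q * (Suc l div q) + Suc l mod q" by simp
    moreover have "Suc l mod q \<le> p" using p by (simp add: less_Suc_eq_le[symmetric])
    ultimately have "Suc l \<le> q * (Suc l div q) + p" by linarith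
    moreover have "q * (Suc a + Suc l div q) \<le> q * Suc l"
      using True by (intro mult_le_mono2) linarith
    ultimately have growth: "q * Suc a \<le> p * Suc (Suc l)"
      unfolding p by (simp add: algebra_simps)
    have "q ^ card (?A (Suc l)) = q * q ^ card (?A l)"
      unfolding card by (rule power_Suc)
    also have "\<dots> \<le> q * (p ^ card (?A l) * Suc a)"
      using IH p by (intro mult_le_mono2) simp
    also have "\<dots> = p ^ card (?A l) * (q * Suc a)" by (simp only: ac_simps)
    also have "\<dots> \<le> p ^ card (?A l) * (p * Suc (Suc l))"
      using growth by (rule mult_le_mono2)
    also have "\<dots> = (q - 1) ^ card (?A (Suc l)) * Suc (pushed_total q L (Suc l))"
      unfolding q1 total card power_Suc mult.assoc by (rule mult.left_commute)
    finally show ?thesis .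
  next
    case False
    \<comment> \<open>\<open>Suc l < L\<close> excludes the clause that forces the last level to
      keep budget.\<close>
    then have total: "pushed_total q L (Suc l) = a"
      using Suc.prems by (simp add: a_def)
    then have "pushed_budget q L (Suc l) = 0"
      by (simp add: pushed_budget_def a_def del: pushed_total.simps)
    then have "?A (Suc l) = ?A l" by (auto simp: le_Suc_eq)
    then show ?thesis using IH total by simp
  qed
qed simp

text \<open>Taking logarithms in \<open>active_growth\<close> bounds the number of active levels
  below \<open>L\<close> by \<open>ln L\<close> divided by \<open>ln (q / (q - 1))\<close>;
  \<open>2 \<le> q\<close> keeps \<open>q - 1\<close> positive there.\<close>

lemma card_active_le:
  assumes q: "2 \<le> q" and L: "1 \<le> L"
  shows "real (card {i \<in> {1..L}. pushed_budget q L i \<noteq> 0}) \<le> real q * ln (real L) + 1"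
proof -
  let ?A = "\<lambda>l. {i \<in> {1..l}. pushed_budget q L i \<noteq> 0}"
  define k where "k = card (?A (L - 1))"
  \<comment> \<open>Level \<open>L\<close> may be active without geometric growth, so it is counted
    apart and yields the summand 1.\<close>
  have "?A L \<subseteq> insert L (?A (L - 1))" by auto
  then have "card (?A L) \<le> card (insert L (?A (L - 1)))"
    by (intro card_mono) auto
  also have "\<dots> \<le> Suc k" by (simp add: k_def card_insert_if)
  finally have card: "card (?A L) \<le> Suc k" .
  have "q ^ k \<le> (q - 1) ^ k * Suc (pushed_total q L (L - 1))"
    unfolding k_def using q L by (intro active_growth) auto
  also have "\<dots> \<le> (q - 1) ^ k * L"
    using pushed_total_le[of q L "L - 1"] L by (intro mult_le_mono2) linarith
  finally have "real (q ^ k) \<le> real ((q - 1) ^ k * L)" by (simp only: of_nat_le_iff)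
  then have "real q ^ k \<le> (real q - 1) ^ k * real L"
    using q by simp
  then have "ln (real q ^ k) \<le> ln ((real q - 1) ^ k * real L)"
    using q L by (subst ln_le_cancel_iff) auto
  then have *: "real k * ln (real q) \<le> real k * ln (real q - 1) + ln (real L)"
    using q L by (simp add: ln_mult ln_realpow)
  \<comment> \<open>The right-hand side is \<open>- 1 / q\<close>, so the logarithm of the growth
    factor is at least \<open>1 / q\<close>.\<close>
  have "ln ((real q - 1) / real q) \<le> (real q - 1) / real q - 1"
    using q by (intro ln_le_minus_one) auto
  then have "1 / real q \<le> ln (real q) - ln (real q - 1)"
    using q by (simp add: ln_div field_simps)
  then have "real k * (1 / real q) \<le> real k * (ln (real q) - ln (real q - 1))"
    by (intro mult_left_mono) auto
  also have "\<dots> \<le> ln (real L)" using * by (simp add: algebra_simps)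
  finally have "real k \<le> real q * ln (real L)"
    using q by (simp add: field_simps)
  then show ?thesis using card by linarith
qed


section \<open>The compressed instance\<close>

lemma depth_budget_update [simp]: "depth (I\<lparr>budget := f\<rparr>) = depth I"
  by (simp add: depth_def level_def)

lemma solution_value_budget_update [simp]:
  "solution_value (I\<lparr>budget := f\<rparr>) S = solution_value I S"
  by (simp add: solution_value_def subtree_def)

lemma up_to_level_budget_update [simp]: "up_to_level (I\<lparr>budget := f\<rparr>) l = up_to_level I l"
  by (simp add: up_to_level_def level_def)

text \<open>Down-pushes change only the levels \<open>1..depth I\<close>, and
  \<open>push_down\<close> relates whole records; hence other budget values are kept.\<close>

definition compress :: "nat \<Rightarrow> instnc \<Rightarrow> instnc" where
  "compress q I = I\<lparr>budget := \<lambda>l. if l \<in> {1..depth I} then pushed_budget q (depth I) l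
                                    else budget I l\<rparr>"

text \<open>
  The intermediate instances of the sweep have collected the not yet assigned budget of the
  levels up to \<open>l\<close> on level \<open>l\<close>.
\<close>

lemma push_down_compress:
  assumes unit: "unit_budget I"
  shows "push_down I (compress q I)"
proof (cases "depth I = 0")
  case True
  then show ?thesis by (simp add: compress_def push_down_def)
next
  case False
  define L where "L = depth I"
  define K where "K l = I\<lparr>budget := \<lambda>i. if i \<in> {1..<l} then pushed_budget q L i
    else if i = l then l - pushed_total q L (l - 1) else budget I i\<rparr>" for l
  have "push_down I (K (Suc l))" if "Suc l \<le> L" for l
    using that
  proof (induction l)
    case 0
    then have "budget I 1 = 1" using unit by (auto simp: unit_budget_def L_def)
    then have "K (Suc 0) = I"
      unfolding K_def by (intro instnc.equality) (auto simp: fun_eq_iff)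
    then show ?case by (simp add: push_down_def)
  next
    case (Suc l)
    let ?a = "pushed_total q L l"
    have al: "?a \<le> l" by (rule pushed_total_le)
    have B: "budget I (Suc (Suc l)) = 1"
      using unit Suc.prems by (auto simp: unit_budget_def L_def)
    show ?case
    proof (cases "pushed_total q L (Suc l) = Suc l")
      case True
      \<comment> \<open>Level \<open>Suc l\<close> keeps all that was collected, so the next level
        starts with just its own unit.\<close>
      then have "K (Suc (Suc l)) = K (Suc l)"
        using B by (intro instnc.equality)
          (auto simp: K_def fun_eq_iff pushed_budget_def less_Suc_eq simp del: pushed_total.simps)
      then show ?thesis using Suc by simp
    next
      case False
      then have eq: "pushed_total q L (Suc l) = ?a" by (auto split: if_splits)
      \<comment> \<open>The collected \<open>Suc l - ?a\<close> units join the unit of the next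
        level, making \<open>Suc (Suc l) - ?a\<close>.\<close>
      have "down_push (K (Suc l)) ((K (Suc l))\<lparr>budget := (budget (K (Suc l)))
          (Suc (Suc l) := budget (K (Suc l)) (Suc l) + budget (K (Suc l)) (Suc (Suc l)),
           Suc l := 0)\<rparr>)"
        using Suc.prems by (intro down_push.intros) (auto simp: K_def L_def)
      also have "\<dots> = K (Suc (Suc l))"
        using B eq al by (intro instnc.equality)
          (auto simp: K_def fun_eq_iff pushed_budget_def less_Suc_eq simp del: pushed_total.simps)
      finally show ?thesis
        using Suc by (auto simp: push_down_def)
    qed
  qed
  from this[of "L - 1"] have "push_down I (K L)" using False by (simp add: L_def)
  \<comment> \<open>As \<open>pushed_total q L L = L\<close>, the amount collected on level
    \<open>L\<close> equals its compressed budget.\<close>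
  also have "K L = compress q I"
    using False by (intro instnc.equality)
      (auto simp: K_def compress_def L_def fun_eq_iff pushed_budget_def pushed_total_final)
  finally show ?thesis .
qed

section \<open>Loss of value under compression\<close>

lemma finite_vertices:
  assumes "firefighter I"
  shows "finite (vertices I)"
proof -
  interpret pair_graph "graph_of I"
    using assms by (simp add: firefighter_def undirected_tree_def)
  show ?thesis by (rule pair_finite_verts)
qed

lemma finite_feasible_values:
  assumes "finite (vertices I)"
  shows "finite {solution_value I S | S. feasible I S}"
proof -
  have "{solution_value I S | S. feasible I S} \<subseteq> solution_value I ` Pow (vertices I)"
    by (auto simp: feasible_def)
  then show ?thesis using assms finite_subset by blast
qed

text \<open>Subtrees may overlap, so each saved vertex is charged to one chosen protector
  \<open>g v\<close>. The charges \<open>c\<close> are additive over the optimal solution, and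
  deleting a light class costs at most a \<open>1 / q\<close> fraction of them.\<close>

lemma val_opt_compress:
  assumes fin: "finite (vertices I)" and unit: "unit_budget I" and q: "0 < q"
  shows "(real q - 1) * real (val_opt I) \<le> real q * real (val_opt (compress q I))"
proof -
  define L where "L = depth I"
  define J where "J = compress q I"
  \<comment> \<open>This makes the set of values nonempty, so that its maximum is attained.\<close>
  have "feasible I {}" by (simp add: feasible_def)
  then have "val_opt I \<in> {solution_value I S | S. feasible I S}"
    unfolding val_opt_def using finite_feasible_values[OF fin] by (intro Max_in) auto
  then obtain S where S: "feasible I S" "val_opt I = solution_value I S" by auto
  have SV: "S \<subseteq> vertices I - {root I}" using S(1) by (simp add: feasible_def)
  have finS: "finite S" using SV fin finite_subset by blast
  define U where "U = (\<Union>u\<in>S. subtree I u)"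
  have finU: "finite U"
    using fin by (rule finite_subset[rotated]) (auto simp: U_def subtree_def)
  have "\<forall>v\<in>U. \<exists>u\<in>S. v \<in> subtree I u" by (auto simp: U_def)
  then obtain g where g: "\<And>v. v \<in> U \<Longrightarrow> g v \<in> S \<and> v \<in> subtree I (g v)" by metis
  define c where "c u = sum (weight I) {v \<in> U. g v = u}" for u
  have c: "sum c R = sum (weight I) {v \<in> U. g v \<in> R}" if "finite R" for R
  proof -
    have "(\<Sum>u\<in>R. sum (weight I) {v \<in> {v \<in> U. g v \<in> R}. g v = u}) =
        sum (weight I) {v \<in> U. g v \<in> R}"
      using that finU by (intro sum.group) auto
    moreover have "{v \<in> {v \<in> U. g v \<in> R}. g v = u} = {v \<in> U. g v = u}" if "u \<in> R" for u
      using that by auto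
    ultimately show ?thesis by (simp add: c_def)
  qed
  \<comment> \<open>The budget constraints count exactly the solution vertices of positive level, so
    these are sparsified.\<close>
  define S1 where "S1 = {s \<in> S. 1 \<le> level I s}"
  have finS1: "finite S1" using finS by (simp add: S1_def)
  obtain R where R: "R \<subseteq> S1" "q * sum c R \<le> sum c S1"
    "\<And>l. card {s \<in> S1 - R. level I s \<le> l} \<le>
       card {s \<in> S1. level I s \<le> l} - card {s \<in> S1. level I s \<le> l} div q"
    using exists_light_sparsification[OF finS1 q, where h = "level I" and c = c] by blast
  have "feasible J (S - R)"
    unfolding feasible_def
  proof (intro conjI ballI)
    show "S - R \<subseteq> vertices J - {root J}"
      using SV by (auto simp: J_def compress_def)
    fix l assume l: "l \<in> {1..depth J}"
    then have lL: "l \<in> {1..L}" by (simp add: J_def compress_def L_def)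
    let ?N = "card {s \<in> S1. level I s \<le> l}"
    have "S \<inter> up_to_level I l = {s \<in> S1. level I s \<le> l}"
      using SV by (auto simp: up_to_level_def S1_def)
    moreover have "(\<Sum>i=1..l. budget I i) = l"
      using unit lL by (simp add: unit_budget_def L_def)
    ultimately have N: "?N \<le> l"
      using S(1) lL unfolding feasible_def L_def by metis
    have "(S - R) \<inter> up_to_level J l = {s \<in> S1 - R. level I s \<le> l}"
      unfolding J_def compress_def up_to_level_budget_update
      using SV by (auto simp: up_to_level_def S1_def)
    then have "card ((S - R) \<inter> up_to_level J l) \<le> ?N - ?N div q"
      using R(3)[of l] by simp
    also have "\<dots> \<le> l - l div q" using N q by (rule sub_div_mono)
    also have "\<dots> \<le> pushed_total q L l" by (rule pushed_total_ge)
    also have "\<dots> = (\<Sum>i=1..l. pushed_budget q L i)" by (simp only: sum_pushed_budget)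
    also have "\<dots> = (\<Sum>i=1..l. budget J i)"
      using lL by (intro sum.cong) (auto simp: J_def compress_def L_def)
    finally show "card ((S - R) \<inter> up_to_level J l) \<le> (\<Sum>i=1..l. budget J i)" .
  qed
  moreover have "finite (vertices J)" using fin by (simp add: J_def compress_def)
  ultimately have "solution_value J (S - R) \<le> val_opt J"
    unfolding val_opt_def by (intro Max_ge finite_feasible_values) auto
  then have opt: "solution_value I (S - R) \<le> val_opt J"
    by (simp add: J_def compress_def)
  have RS: "R \<subseteq> S" "finite R"
    using R(1) finS by (auto simp: S1_def intro: finite_subset)
  \<comment> \<open>A vertex charged to a surviving protector is still saved; others may be saved as
    well, hence only an inequality.\<close>
  have "sum c (S - R) \<le> solution_value I (S - R)"
  proof -
    have "{v \<in> U. g v \<in> S - R} \<subseteq> (\<Union>u\<in>S - R. subtree I u)"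
      using g by blast
    moreover have "finite (\<Union>u\<in>S - R. subtree I u)"
      using fin by (rule finite_subset[rotated]) (auto simp: subtree_def)
    ultimately show ?thesis
      using finS by (simp add: c solution_value_def sum_mono2)
  qed
  moreover have "{v \<in> U. g v \<in> S} = U" using g by auto
  then have total: "sum c S = val_opt I"
    using S(2) finS by (simp add: c solution_value_def U_def)
  moreover have "sum c S = sum c (S - R) + sum c R"
    using RS finS by (intro sum.subset_diff) auto
  ultimately have "val_opt I \<le> val_opt J + sum c R" using opt by linarith
  then have "q * val_opt I \<le> q * val_opt J + q * sum c R"
    by (metis distrib_left mult_le_mono2)
  also have "sum c S1 \<le> sum c S" using finS by (intro sum_mono2) (auto simp: S1_def)
  then have "q * sum c R \<le> val_opt I" using R(2) total by simp
  finally have "q * val_opt I \<le> q * val_opt J + val_opt I" by simp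
  then have "real (q * val_opt I) \<le> real (q * val_opt J + val_opt I)" by (simp only: of_nat_le_iff)
  then show ?thesis by (simp add: J_def algebra_simps)
qed

lemma active_levels_compress:
  "active_levels (compress q I) = {i \<in> {1..depth I}. pushed_budget q (depth I) i \<noteq> 0}"
  by (auto simp: active_levels_def compress_def)


section \<open>Computing the compressed instance\<close>

fun loop_free :: "program \<Rightarrow> bool" where
  "loop_free Skip \<longleftrightarrow> True"
| "loop_free (Op i) \<longleftrightarrow> True"
| "loop_free (Seq P Q) \<longleftrightarrow> loop_free P \<and> loop_free Q"
| "loop_free (IfNZ x P Q) \<longleftrightarrow> loop_free P \<and> loop_free Q"
| "loop_free (WhileNZ x P) \<longleftrightarrow> False"

text \<open>A functional form of \<open>exec\<close> for loop-free programs; the clause for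
  \<open>WhileNZ\<close> is a dummy.\<close>

fun run :: "program \<Rightarrow> state \<Rightarrow> state" where
  "run Skip s = s"
| "run (Op i) s = step i s"
| "run (Seq P Q) s = run Q (run P s)"
| "run (IfNZ x P Q) s = (if fst s x \<noteq> 0 then run P s else run Q s)"
| "run (WhileNZ x P) s = s"

text \<open>Both branches of a conditional are charged, giving a bound independent of the state. The
  clause for \<open>WhileNZ\<close> is a dummy.\<close>

fun cost :: "program \<Rightarrow> nat" where
  "cost Skip = 1"
| "cost (Op i) = 1"
| "cost (Seq P Q) = cost P + cost Q"
| "cost (IfNZ x P Q) = cost P + cost Q + 1"
| "cost (WhileNZ x P) = 0"

lemma exec_run: "loop_free P \<Longrightarrow> \<exists>t\<le>cost P. exec P s t (run P s)"
proof (induction P arbitrary: s)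
  case (Seq P Q)
  from Seq.IH(1)[of s] Seq.prems obtain t where t: "t \<le> cost P" "exec P s t (run P s)" by auto
  from Seq.IH(2)[of "run P s"] Seq.prems obtain u
    where u: "u \<le> cost Q" "exec Q (run P s) u (run Q (run P s))" by auto
  show ?case using exec_Seq[OF t(2) u(2)] t(1) u(1) by (auto intro!: exI[of _ "t + u"])
next
  case (IfNZ x P Q)
  show ?case
  proof (cases "fst s x = 0")
    case True
    from IfNZ.IH(2)[of s] IfNZ.prems obtain t
      where t: "t \<le> cost Q" "exec Q s t (run Q s)" by auto
    then show ?thesis
      using exec_IfFalse[OF True t(2), of P] True by (intro exI[of _ "t + 1"]) simp
  next
    case False
    from IfNZ.IH(1)[of s] IfNZ.prems obtain t
      where t: "t \<le> cost P" "exec P s t (run P s)" by auto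
    then show ?thesis
      using exec_IfTrue[OF False t(2), of Q] False by (intro exI[of _ "t + 1"]) simp
  qed
next
  case Skip
  show ?case using exec_Skip[of s] by auto
next
  case (Op i)
  show ?case using exec_Op[of i s] by auto
qed simp

text \<open>The tested register holds the number \<open>k\<close> of remaining rounds. A round pays
  at most \<open>cost P\<close> plus one test, and the final failing test pays 1.\<close>

lemma exec_while_invariant:
  assumes "loop_free P"
    and step: "\<And>k s. Inv (Suc k) s \<Longrightarrow> Inv k (run P s)"
    and test: "\<And>k s. Inv k s \<Longrightarrow> fst s x = k"
    and "Inv k s"
  shows "\<exists>t s'. exec (WhileNZ x P) s t s' \<and> t \<le> (cost P + 1) * k + 1 \<and> Inv 0 s'"
  using \<open>Inv k s\<close>
proof (induction k arbitrary: s)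
  case 0
  then have "exec (WhileNZ x P) s 1 s" using test by (intro exec_WhileFalse) simp
  with 0 show ?case by (intro exI[of _ 1] exI[of _ s]) simp
next
  case (Suc k)
  obtain t where t: "t \<le> cost P" "exec P s t (run P s)"
    using exec_run[OF assms(1)] by blast
  obtain u s' where u: "exec (WhileNZ x P) (run P s) u s'" "u \<le> (cost P + 1) * k + 1" "Inv 0 s'"
    using Suc.IH[OF step[OF Suc.prems]] by blast
  have "exec (WhileNZ x P) s (t + u + 1) s'"
    using test[OF Suc.prems] t(2) u(1) by (intro exec_WhileTrue) auto
  moreover have "t + u + 1 \<le> (cost P + 1) * Suc k + 1"
    using t(1) u(2) by simp
  ultimately show ?case using u(3) by (intro exI[of _ "t + u + 1"] exI[of _ s'] conjI)
qed

text \<open>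
  Registers: 0 and 1 hold \<open>a\<close> and \<open>b\<close>, 2 the number of remaining levels, 3 the current level
  \<open>l\<close>, 4 and 5 the values \<open>(l mod q) * a\<close> and \<open>l div q\<close> for \<open>q = \<lceil>b / a\<rceil>\<close>, which is never
  computed itself (it can be exponential in the input size), 6 the last active level, 7 the
  constant one, 8 a temporary value, 9 the constant zero.
\<close>

definition count_level :: program where
  "count_level =
    Seq (Op (Add 3 3 7)) (
    Seq (Op (Sub 2 2 7)) (
    Seq (Op (Add 4 4 0)) (
    Seq (Op (Sub 8 1 4)) (
    IfNZ 8 Skip (Seq (Op (Const 4 0)) (Op (Add 5 5 7)))))))"

text \<open>After two subtractions, register 8 is nonzero exactly if the last active level is below
  \<open>l - l div q\<close>. It is set to 1 when no level remains, which forces the last level to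
  keep budget. Adding register 9 copies a value.\<close>

definition write_budget :: program where
  "write_budget =
    Seq (Op (Sub 8 3 5)) (
    Seq (Op (Sub 8 8 6)) (
    Seq (IfNZ 2 Skip (Op (Const 8 1))) (
    IfNZ 8
      (Seq (Op (Sub 8 3 6)) (Seq (Op (Store 3 8)) (Op (Add 6 3 9))))
      (Op (Store 3 9)))))"

definition sweep_body :: program where
  "sweep_body = Seq count_level write_budget"

text \<open>Register 9 is initially zero, so the load fetches memory cell 0, where the encoding
  stores the depth.\<close>

definition sweep :: program where
  "sweep = Seq (Seq (Op (Load 2 9)) (Op (Const 7 1))) (WhileNZ 2 sweep_body)"

text \<open>\<open>k\<close> counts the levels still to be treated, as
  \<open>exec_while_invariant\<close> expects. The budget of level \<open>i\<close> lies in cell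
  \<open>i\<close>, so the sweep overwrites it in place.\<close>

definition sweep_inv ::
  "nat \<Rightarrow> nat \<Rightarrow> nat \<Rightarrow> nat \<Rightarrow> (nat \<Rightarrow> nat) \<Rightarrow> nat \<Rightarrow> state \<Rightarrow> bool" where
  "sweep_inv a b q L m0 k s \<longleftrightarrow> k \<le> L \<and> fst s 0 = a \<and> fst s 1 = b \<and> fst s 2 = k \<and>
     fst s 3 = L - k \<and> fst s 4 = ((L - k) mod q) * a \<and> fst s 5 = (L - k) div q \<and>
     fst s 6 = pushed_total q L (L - k) \<and> fst s 7 = 1 \<and> fst s 9 = 0 \<and>
     (\<forall>i. snd s i = (if i \<in> {1..L - k} then pushed_budget q L i else m0 i))"

text \<open>\<open>qab\<close> pins down \<open>q\<close> as the rounded-up quotient of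
  \<open>b\<close> by \<open>a\<close> through multiples of \<open>a\<close> alone, which addition
  and comparison can test.\<close>

lemma sweep_inv_step:
  assumes q: "0 < q" and qab: "\<And>i. b \<le> i * a \<longleftrightarrow> q \<le> i"
    and inv: "sweep_inv a b q L m0 (Suc k) s"
  shows "sweep_inv a b q L m0 k (run sweep_body s)"
proof -
  obtain r m where s: "s = (r, m)" by (cases s)
  define l where "l = L - Suc k"
  have l: "L - k = Suc l" "Suc l = L \<longleftrightarrow> k = 0" "k \<le> L"
    using inv by (auto simp: l_def sweep_inv_def)
  have r: "r 0 = a" "r (Suc 0) = b" "r 2 = Suc k" "r 3 = l" "r 4 = (l mod q) * a" "r 5 = l div q"
      "r 6 = pushed_total q L l" "r 7 = 1" "r 9 = 0"
    and m: "\<And>i. m i = (if i \<in> {1..l} then pushed_budget q L i else m0 i)"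
    using inv by (auto simp: sweep_inv_def s l_def)
  \<comment> \<open>Register 4 first reaches \<open>b\<close> after \<open>q\<close> additions of
    \<open>a\<close>, so the comparison with \<open>b\<close> detects the end of a block of
    \<open>q\<close> levels.\<close>
  have "l mod q < q" using q by simp
  then have full: "b \<le> (l mod q) * a + a \<longleftrightarrow> Suc (l mod q) = q"
    using qab[of "Suc (l mod q)"] by (auto simp: algebra_simps)
  obtain r' where count: "run count_level (r, m) = (r', m)"
    and r': "r' 0 = a" "r' (Suc 0) = b" "r' 2 = k" "r' 3 = Suc l" "r' 4 = (Suc l mod q) * a"
      "r' 5 = Suc l div q" "r' 6 = pushed_total q L l" "r' 7 = 1" "r' 9 = 0"
  proof (cases "Suc (l mod q) = q")
    case True
    then have "b \<le> (l mod q) * a + a" using full by simp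
    moreover have "Suc l mod q = 0" "Suc l div q = Suc (l div q)"
      using True by (simp_all add: mod_Suc div_Suc)
    ultimately show thesis
      using r by (intro that[of "fst (run count_level (r, m))"]) (simp_all add: count_level_def)
  next
    case False
    then have "\<not> b \<le> (l mod q) * a + a" using full by simp
    moreover have "Suc l mod q = Suc (l mod q)" "Suc l div q = l div q"
      using False by (simp_all add: mod_Suc div_Suc)
    ultimately show thesis
      using r by (intro that[of "fst (run count_level (r, m))"]) (simp_all add: count_level_def)
  qed
  obtain r'' where
    written: "run write_budget (r', m) = (r'', m(Suc l := pushed_budget q L (Suc l)))"
    and r'': "r'' 0 = a" "r'' 1 = b" "r'' 2 = k" "r'' 3 = Suc l" "r'' 4 = (Suc l mod q) * a"
      "r'' 5 = Suc l div q" "r'' 6 = pushed_total q L (Suc l)" "r'' 7 = 1" "r'' 9 = 0"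
  proof (cases "pushed_total q L l < Suc l - Suc l div q \<or> k = 0")
    case True
    then have total: "pushed_total q L (Suc l) = Suc l" using l(2) by simp
    have "run write_budget (r', m) =
        (r'(8 := Suc l - pushed_total q L l, 6 := Suc l), m(Suc l := Suc l - pushed_total q L l))"
      using r' True pushed_total_le[of q L l] by (auto simp: write_budget_def fun_eq_iff)
    then show thesis
      using r' by (intro that[of "r'(8 := Suc l - pushed_total q L l, 6 := Suc l)"])
        (simp_all add: pushed_budget_def total del: pushed_total.simps)
  next
    case False
    then have total: "pushed_total q L (Suc l) = pushed_total q L l" using l(2) by simp
    have "run write_budget (r', m) = (r'(8 := 0), m(Suc l := 0))"
      using r' False by (auto simp: write_budget_def fun_eq_iff)
    then show thesis
      using r' by (intro that[of "r'(8 := 0)"])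
        (simp_all add: pushed_budget_def total del: pushed_total.simps)
  qed
  have "(m(Suc l := pushed_budget q L (Suc l))) i =
      (if i \<in> {1..Suc l} then pushed_budget q L i else m0 i)" for i
    by (auto simp: m le_Suc_eq)
  moreover have "run sweep_body s = (r'', m(Suc l := pushed_budget q L (Suc l)))"
    by (simp add: sweep_body_def s count written)
  ultimately show ?thesis
    unfolding sweep_inv_def l(1) using l(3) r'' by (simp only: fst_conv snd_conv) blast
qed

section \<open>Correctness and running time of the sweep\<close>

lemma encode_compress:
  assumes "i < length (encode I)"
  shows "encode (compress q I) ! i =
    (if i \<in> {1..depth I} then pushed_budget q (depth I) i else encode I ! i)"
proof -
  define rest where "rest = root I # length (vertex_list I) # vertex_list I @
     map (weight I) (filter (\<lambda>v. v \<noteq> root I) (vertex_list I)) @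
     length (arc_list I) # concat (map (\<lambda>(u, v). [u, v]) (arc_list I))"
  have "map (budget (compress q I)) [1..<Suc (depth I)] =
      map (pushed_budget q (depth I)) [1..<Suc (depth I)]"
    by (auto simp: compress_def)
  then have J: "encode (compress q I) =
      depth I # map (pushed_budget q (depth I)) [1..<Suc (depth I)] @ rest"
    by (simp add: encode_def rest_def compress_def vertex_list_def arc_list_def)
  have I: "encode I = depth I # map (budget I) [1..<Suc (depth I)] @ rest"
    by (simp add: encode_def rest_def)
  show ?thesis
    unfolding I J by (auto simp: nth_Cons nth_append simp del: upt_Suc split: nat.split)
qed

lemma length_encode_compress: "length (encode (compress q I)) = length (encode I)"
  by (simp add: encode_def compress_def vertex_list_def arc_list_def)

text \<open>The constant 3 covers the two initial operations and the final loop test.\<close>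

lemma sweep_computes:
  assumes "0 < q" and "\<And>i. b \<le> i * a \<longleftrightarrow> q \<le> i"
  shows "computes_within sweep [a, b] (encode I) (encode (compress q I))
    ((cost sweep_body + 1) * depth I + 3)"
proof -
  let ?L = "depth I" and ?m = "zero_padded (encode I)"
  let ?init = "Seq (Op (Load 2 9)) (Op (Const 7 1))"
  let ?s = "(zero_padded [a, b], ?m)"
  have "encode I \<noteq> []" "encode I ! 0 = ?L" by (simp_all add: encode_def)
  then have "sweep_inv a b q ?L ?m ?L (run ?init ?s)"
    by (auto simp: sweep_inv_def zero_padded_def)
  moreover have "loop_free sweep_body"
    by (simp add: sweep_body_def count_level_def write_budget_def)
  moreover have "fst s 2 = k" if "sweep_inv a b q ?L ?m k s" for k s
    using that by (simp add: sweep_inv_def)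
  ultimately obtain t s' where t: "exec (WhileNZ 2 sweep_body) (run ?init ?s) t s'"
      "t \<le> (cost sweep_body + 1) * ?L + 1" "sweep_inv a b q ?L ?m 0 s'"
    using exec_while_invariant[where Inv = "sweep_inv a b q ?L ?m" and x = 2 and P = sweep_body,
        OF _ sweep_inv_step[OF assms]] by blast
  obtain u where u: "u \<le> 2" "exec ?init ?s u (run ?init ?s)"
    using exec_run[of ?init ?s] by (simp only: loop_free.simps cost.simps one_add_one) blast
  obtain r m where s': "s' = (r, m)" by (cases s')
  have "exec sweep ?s (u + t) (r, m)"
    unfolding sweep_def using exec_Seq[OF u(2) t(1)] s' by simp
  moreover have "u + t \<le> (cost sweep_body + 1) * ?L + 3" using u(1) t(2) by linarith
  moreover have "m i = encode (compress q I) ! i" if "i < length (encode I)" for i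
    using t(3) that by (simp add: sweep_inv_def s' encode_compress zero_padded_def)
  ultimately show ?thesis
    unfolding computes_within_def length_encode_compress by blast
qed

lemma length_le_bit_size: "length xs \<le> bit_size xs"
  by (induction xs) (auto simp: bit_size_def)

text \<open>The encoding has one budget entry per level, and every entry contributes at least its
  separator.\<close>

lemma depth_le_bit_size: "depth I \<le> bit_size (encode I)"
proof -
  have "depth I \<le> length (encode I)" by (simp add: encode_def del: upt_Suc)
  then show ?thesis using length_le_bit_size[of "encode I"] by (rule le_trans)
qed

lemma nat_ceiling_bounds:
  fixes x :: real
  assumes "1 < x"
  shows "2 \<le> nat \<lceil>x\<rceil>" "x \<le> real (nat \<lceil>x\<rceil>)" "real (nat \<lceil>x\<rceil>) \<le> x + 1"
proof -
  have "1 < \<lceil>x\<rceil>" using assms by (simp add: less_ceiling_iff)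
  then show "2 \<le> nat \<lceil>x\<rceil>" "x \<le> real (nat \<lceil>x\<rceil>)" "real (nat \<lceil>x\<rceil>) \<le> x + 1"
    using ceiling_correct[of x] by (simp_all add: le_nat_iff)
qed

text \<open>With \<open>q\<close> the rounded-up \<open>b / a\<close>, the loss is
  \<open>1 / q \<le> a / b\<close>, while \<open>q \<le> 2 * (b / a)\<close> controls the number of
  levels. Absorbing the additive 1 doubles the factor 2 to 4.\<close>

lemma compression:
  assumes ab: "0 < a" "a < b" and I: "firefighter I" "unit_budget I"
  defines "J \<equiv> compress (nat \<lceil>real b / real a\<rceil>) I"
  shows "computes_within sweep [a, b] (encode I) (encode J) ((cost sweep_body + 1) * depth I + 3)"
    and "push_down I J"
    and "(1 - real a / real b) * real (val_opt I) \<le> real (val_opt J)"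
    and "2 \<le> depth I \<Longrightarrow>
      real (card (active_levels J)) \<le> 4 * (ln (real (depth I)) / (real a / real b))"
proof -
  define q where "q = nat \<lceil>real b / real a\<rceil>"
  have "1 < real b / real a" using ab by simp
  note q_bounds = nat_ceiling_bounds[OF this, folded q_def]
  have q2: "2 \<le> q" and qge: "real b / real a \<le> real q" and qle: "real q \<le> real b / real a + 1"
    by (rule q_bounds)+
  have "b \<le> i * a \<longleftrightarrow> q \<le> i" for i
  proof -
    have "b \<le> i * a \<longleftrightarrow> real b \<le> real i * real a"
      by (metis of_nat_le_iff of_nat_mult)
    also have "\<dots> \<longleftrightarrow> q \<le> i"
      using ab by (simp add: q_def ceiling_le_iff nat_le_iff pos_divide_le_eq)
    finally show ?thesis .
  qed
  then show "computes_within sweep [a, b] (encode I) (encode J)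
      ((cost sweep_body + 1) * depth I + 3)"
    unfolding J_def q_def[symmetric] using q2 by (intro sweep_computes) auto
  show "push_down I J" unfolding J_def using I(2) by (rule push_down_compress)
  show "(1 - real a / real b) * real (val_opt I) \<le> real (val_opt J)"
  proof -
    have "(real q - 1) * real (val_opt I) \<le> real q * real (val_opt J)"
      unfolding J_def q_def[symmetric]
      using q2 I by (intro val_opt_compress finite_vertices) auto
    then have "(1 - 1 / real q) * real (val_opt I) \<le> real (val_opt J)"
      using q2 by (simp add: field_simps)
    moreover have "1 / real q \<le> real a / real b"
      using qge ab q2 by (simp add: field_simps)
    then have "(1 - real a / real b) * real (val_opt I) \<le> (1 - 1 / real q) * real (val_opt I)"
      by (intro mult_right_mono) auto
    ultimately show ?thesis by linarith
  qed
  assume L: "2 \<le> depth I"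
  \<comment> \<open>A positive lower bound on \<open>ln (depth I)\<close> is what lets the additive
    1 be absorbed.\<close>
  have "ln (1 / 2 :: real) \<le> 1 / 2 - 1" by (rule ln_le_minus_one) simp
  then have "1 / 2 \<le> ln (2 :: real)" by (simp add: ln_div)
  also have "\<dots> \<le> ln (real (depth I))" using L by simp
  finally have ln: "1 / 2 \<le> ln (real (depth I))" .
  have "real (card (active_levels J)) \<le> real q * ln (real (depth I)) + 1"
    unfolding J_def q_def[symmetric] active_levels_compress
    using q2 L by (intro card_active_le) auto
  also have "\<dots> \<le> 2 * (real b / real a) * ln (real (depth I)) +
      2 * (real b / real a) * ln (real (depth I))"
  proof (rule add_mono)
    show "real q * ln (real (depth I)) \<le> 2 * (real b / real a) * ln (real (depth I))"
      using qle \<open>1 < real b / real a\<close> ln by (intro mult_right_mono) auto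
    have "1 * 1 \<le> (real b / real a) * (2 * ln (real (depth I)))"
      using \<open>1 < real b / real a\<close> ln by (intro mult_mono) auto
    then show "1 \<le> 2 * (real b / real a) * ln (real (depth I))"
      by (simp only: mult_1 mult.assoc mult.left_commute)
  qed
  finally show "real (card (active_levels J)) \<le> 4 * (ln (real (depth I)) / (real a / real b))"
    by (simp add: algebra_simps)
qed

text \<open>For fixed \<delta> the two arguments are hard-wired by constant assignments, at two
  extra time units.\<close>

lemma computes_within_constants:
  assumes "computes_within P [a, b] xs ys T"
  shows "computes_within (Seq (Op (Const 0 a)) (Seq (Op (Const 1 b)) P)) [] xs ys (T + 2)"
proof -
  obtain t r m where t: "exec P (zero_padded [a, b], zero_padded xs) t (r, m)" "t \<le> T"
      "\<forall>i<length ys. m i = ys ! i"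
    using assms by (auto simp: computes_within_def)
  let ?s = "(zero_padded [], zero_padded xs)"
  have "zero_padded [a, b] = (zero_padded [])(0 := a, 1 := b)"
    by (auto simp: fun_eq_iff zero_padded_def less_Suc_eq)
  then have P: "exec P (step (Const 1 b) (step (Const 0 a) ?s)) t (r, m)"
    using t(1) by simp
  have "exec (Seq (Op (Const 0 a)) (Seq (Op (Const 1 b)) P)) ?s (1 + (1 + t)) (r, m)"
    by (rule exec_Seq[OF exec_Op exec_Seq[OF exec_Op P]])
  moreover have "1 + (1 + t) \<le> T + 2" using t(2) by simp
  ultimately show ?thesis unfolding computes_within_def using t(3) by blast
qed

lemma computes_within_mono:
  "computes_within P args xs ys T \<Longrightarrow> T \<le> T' \<Longrightarrow> computes_within P args xs ys T'"
  unfolding computes_within_def by (meson le_trans)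

theorem theorem16:
  shows "\<exists>C::real.
    (\<forall>\<delta>::real. 0 < \<delta> \<and> \<delta> < 1 \<longrightarrow>
      (\<exists>(P::program) (p::nat poly). \<forall>I. firefighter I \<and> unit_budget I \<longrightarrow>
        (\<exists>J. computes_within P [] (encode I) (encode J) (poly p (bit_size (encode I))) \<and>
             push_down I J \<and>
             real (val_opt J) \<ge> (1 - \<delta>) * real (val_opt I) \<and>
             (2 \<le> depth I \<longrightarrow> real (card (active_levels J)) \<le> C * (ln (real (depth I)) / \<delta>))))) \<and>
    (\<exists>(P::program) (p::nat poly). \<forall>(a::nat) (b::nat) (\<delta>::real) I.
        0 < a \<and> a < b \<and> \<delta> = real a / real b \<and> firefighter I \<and> unit_budget I \<longrightarrow>
        (\<exists>J. computes_within P [a, b] (encode I) (encode J) (poly p (bit_size ([a, b] @ encode I))) \<and>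
             push_down I J \<and>
             real (val_opt J) \<ge> (1 - \<delta>) * real (val_opt I) \<and>
             (2 \<le> depth I \<longrightarrow> real (card (active_levels J)) \<le> C * (ln (real (depth I)) / \<delta>))))"
proof (intro exI[of _ 8] conjI allI impI, goal_cases)
  case (1 \<delta>)
  \<comment> \<open>A real \<delta> is replaced by the rational \<open>1 / b \<le> \<delta>\<close>;
    since \<open>b \<le> 2 / \<delta>\<close>, the constant 4 of \<open>compression\<close> becomes
    8.\<close>
  define b where "b = nat \<lceil>1 / \<delta>\<rceil>"
  have "1 < 1 / \<delta>" using 1 by simp
  note b_bounds = nat_ceiling_bounds[OF this, folded b_def]
  have b2: "2 \<le> b" by (rule b_bounds)
  have b_ge: "1 / real b \<le> \<delta>" using b_bounds(2) 1 b2 by (simp add: field_simps)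
  have b_le: "real b \<le> 2 * (1 / \<delta>)" using b_bounds(3) \<open>1 < 1 / \<delta>\<close> by linarith
  let ?P = "Seq (Op (Const 0 1)) (Seq (Op (Const 1 b)) sweep)"
  let ?p = "[:5, cost sweep_body + 1:] :: nat poly"
  show ?case
  proof (intro exI[of _ ?P] exI[of _ ?p] allI impI, elim conjE)
    fix I assume I: "firefighter I" "unit_budget I"
    have "1 < b" using b2 by simp
    note comp = compression[OF zero_less_one this I]
    let ?J = "compress (nat \<lceil>real b / real 1\<rceil>) I"
    have "computes_within ?P [] (encode I) (encode ?J) (poly ?p (bit_size (encode I)))"
    proof (rule computes_within_mono[OF computes_within_constants[OF comp(1)]])
      have "(cost sweep_body + 1) * depth I \<le> (cost sweep_body + 1) * bit_size (encode I)"
        by (intro mult_le_mono2 depth_le_bit_size)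
      then show "(cost sweep_body + 1) * depth I + 3 + 2 \<le> poly ?p (bit_size (encode I))"
        by (simp add: mult.commute)
    qed
    moreover have "(1 - \<delta>) * real (val_opt I) \<le> (1 - real 1 / real b) * real (val_opt I)"
      using b_ge by (intro mult_right_mono) auto
    then have "(1 - \<delta>) * real (val_opt I) \<le> real (val_opt ?J)"
      using comp(3) by linarith
    moreover have "real (card (active_levels ?J)) \<le> 8 * (ln (real (depth I)) / \<delta>)"
      if L: "2 \<le> depth I"
    proof -
      have "real (card (active_levels ?J)) \<le> 4 * ln (real (depth I)) * real b"
        using comp(4)[OF L] by simp
      also have "\<dots> \<le> 4 * ln (real (depth I)) * (2 * (1 / \<delta>))"
        using b_le L by (intro mult_left_mono) auto
      finally show ?thesis by simp
    qed
    ultimately show "\<exists>J. computes_within ?P [] (encode I) (encode J) (poly ?p (bit_size (encode I))) \<and>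
        push_down I J \<and> (1 - \<delta>) * real (val_opt I) \<le> real (val_opt J) \<and>
        (2 \<le> depth I \<longrightarrow> real (card (active_levels J)) \<le> 8 * (ln (real (depth I)) / \<delta>))"
      using comp(2) by blast
  qed
next
  case 2
  \<comment> \<open>Here \<open>a\<close> and \<open>b\<close> are inputs, so one program and one
    polynomial serve every rational \<delta>.\<close>
  let ?p = "[:3, cost sweep_body + 1:] :: nat poly"
  show ?case
  proof (intro exI[of _ sweep] exI[of _ ?p] allI impI, elim conjE)
    fix a b \<delta> I
    assume ab: "0 < a" "a < b" and \<delta>: "\<delta> = real a / real b"
      and I: "firefighter I" "unit_budget I"
    note comp = compression[OF ab I]
    let ?J = "compress (nat \<lceil>real b / real a\<rceil>) I"
    have "computes_within sweep [a, b] (encode I) (encode ?J)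
        (poly ?p (bit_size ([a, b] @ encode I)))"
    proof (rule computes_within_mono[OF comp(1)])
      have "depth I \<le> bit_size ([a, b] @ encode I)"
        using depth_le_bit_size[of I] by (simp add: bit_size_def)
      then have "(cost sweep_body + 1) * depth I \<le>
          (cost sweep_body + 1) * bit_size ([a, b] @ encode I)"
        by (rule mult_le_mono2)
      then show "(cost sweep_body + 1) * depth I + 3 \<le> poly ?p (bit_size ([a, b] @ encode I))"
        by (simp add: mult.commute)
    qed
    moreover have "real (card (active_levels ?J)) \<le> 8 * (ln (real (depth I)) / \<delta>)"
      if L: "2 \<le> depth I"
    proof -
      have "0 \<le> ln (real (depth I)) / \<delta>" using L \<delta> by simp
      then show ?thesis using comp(4)[OF L] unfolding \<delta> by linarith
    qed
    ultimately show "\<exists>J. computes_within sweep [a, b] (encode I) (encode J)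
          (poly ?p (bit_size ([a, b] @ encode I))) \<and>
        push_down I J \<and> (1 - \<delta>) * real (val_opt I) \<le> real (val_opt J) \<and>
        (2 \<le> depth I \<longrightarrow> real (card (active_levels J)) \<le> 8 * (ln (real (depth I)) / \<delta>))"
      using comp(2,3) unfolding \<delta> by blast
  qed
qed

end
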